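(* Let $\mathcal X$ be a complex Banach space, let $A,B,C$ be bounded linear operators on $\mathcal X$, and let $\|\cdot\|$ be the induced operator norm. Let $X$ be the solution (a bounded operator) of $AX+XB+C=0$. Let $k\ge 1$ and let $\alpha_1,\dots,\alpha_k,\beta_1,\dots,\beta_k\in\mathbb C$ be parameters with $\beta_j\notin\sigma(A)$ and $\alpha_j\notin\sigma(-B)$ for all $j$. Let $X^{(k)}$ be the approximation obtained after $k$ steps of the ADI iteration with these parameters. Let $z_A,z_B\in\mathbb C$ and real numbers $\rho_A,\rho_A',\rho_B,\rho_B'$ be such that $$\|A-z_AI\|\le\rho_A'<\rho_A,\qquad \|B-z_BI\|\le\rho_B'<\rho_B .$$ Define $r_k(z):=\prod_{j=1}^k\frac{z-\alpha_j}{z-\beta_j}$. Then $$\|X-X^{(k)}\|\le \|X\|\cdot\frac{\rho_A\rho_B}{(\rho_A-\rho_A')(\rho_B-\rho_B')}\cdot\frac{\sup_{z\in B(z_A,\rho_A)}|r_k(z)|}{\inf_{z\in B(z_B,\rho_B)}|r_k(-z)|}.$$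
   Context: $\sigma(\cdot)$ denotes the spectrum of a bounded operator. $B(z_0,\rho)$ (with two arguments) denotes the open ball in $\mathbb C$ of center $z_0$ and radius $\rho$; $B$ alone is the operator. Scalars in operator expressions denote multiples of the identity. The ADI iteration for $AX+XB+C=0$ with parameters $\alpha_j,\beta_j$ starts from $X^{(0)}:=0$ and is defined by $$X^{(j+\frac12)}:=-(A-\beta_{j+1}I)^{-1}X^{(j)}(B+\beta_{j+1}I)-(A-\beta_{j+1}I)^{-1}C,$$ $$X^{(j+1)}:=-(A-\alpha_{j+1}I)X^{(j+\frac12)}(B+\alpha_{j+1}I)^{-1}-C(B+\alpha_{j+1}I)^{-1}.$$ The rational function $r_k$ is assigned modulus $+\infty$ at its poles; if the supremum is $+\infty$ or the infimum is $0$, the right-hand side is understood as $+\infty$ and the inequality is vacuous. *)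

theory Defs
  imports
    "HOL-Analysis.Analysis"
    "HOL-Computational_Algebra.Computational_Algebra"
    "HOL-Computational_Algebra.Field_as_Ring"
begin

text \<open>
  The distribution only has real Banach spaces. A complex Banach space is a real Banach space
  with a complex scalar multiplication that extends the real one and for which the norm is
  homogeneous.
\<close>

class complex_banach = banach +
  fixes scaleC :: "complex \<Rightarrow> 'a \<Rightarrow> 'a"  (infixr "*\<^sub>C" 75)
  assumes scaleC_add_right: "c *\<^sub>C (x + y) = c *\<^sub>C x + c *\<^sub>C y"
    and scaleC_add_left: "(c + d) *\<^sub>C x = c *\<^sub>C x + d *\<^sub>C x"
    and scaleC_scaleC: "c *\<^sub>C (d *\<^sub>C x) = (c * d) *\<^sub>C x"
    and scaleC_complex_of_real: "complex_of_real r *\<^sub>C x = r *\<^sub>R x"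
    and norm_scaleC: "norm (c *\<^sub>C x) = cmod c * norm x"

instantiation complex :: complex_banach
begin

definition scaleC_complex :: "complex \<Rightarrow> complex \<Rightarrow> complex"
  where "scaleC_complex c x = c * x"

instance
  by standard (simp_all add: scaleC_complex_def algebra_simps norm_mult scaleR_conv_of_real)

end

text \<open>
  Bounded operators on \<open>'a\<close> are the complex-linear elements of \<open>'a \<Rightarrow>\<^sub>L 'a\<close>; the norm of that type is
  the induced operator norm.
\<close>

definition complex_linear :: "('a::complex_banach \<Rightarrow>\<^sub>L 'a) \<Rightarrow> bool"
  where "complex_linear T \<longleftrightarrow> (\<forall>c x. blinfun_apply T (c *\<^sub>C x) = c *\<^sub>C blinfun_apply T x)"

lift_definition scalar_op :: "complex \<Rightarrow> ('a::complex_banach \<Rightarrow>\<^sub>L 'a)"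
  is "\<lambda>z x. z *\<^sub>C x"
proof -
  fix z :: complex
  show "bounded_linear (\<lambda>x::'a. z *\<^sub>C x)"
  proof (rule bounded_linear_intro[where K = "cmod z"])
    fix r :: real and x :: 'a
    show "z *\<^sub>C (r *\<^sub>R x) = r *\<^sub>R (z *\<^sub>C x)"
      by (simp flip: scaleC_complex_of_real add: scaleC_scaleC mult.commute)
  qed (simp_all add: scaleC_add_right norm_scaleC mult.commute)
qed

definition is_op_inverse :: "('a::complex_banach \<Rightarrow>\<^sub>L 'a) \<Rightarrow> ('a \<Rightarrow>\<^sub>L 'a) \<Rightarrow> bool"
  where "is_op_inverse T S \<longleftrightarrow>
    complex_linear S \<and> T o\<^sub>L S = id_blinfun \<and> S o\<^sub>L T = id_blinfun"

definition op_inverse :: "('a::complex_banach \<Rightarrow>\<^sub>L 'a) \<Rightarrow> ('a \<Rightarrow>\<^sub>L 'a)"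
  where "op_inverse T = (THE S. is_op_inverse T S)"

definition spectrum :: "('a::complex_banach \<Rightarrow>\<^sub>L 'a) \<Rightarrow> complex set"
  where "spectrum T = {z. \<not> (\<exists>S. is_op_inverse (T - scalar_op z) S)}"

text \<open>The parameter sequences are indexed from 1; their values at 0 are never used.\<close>

definition adi_half_step ::
  "('a::complex_banach \<Rightarrow>\<^sub>L 'a) \<Rightarrow> ('a \<Rightarrow>\<^sub>L 'a) \<Rightarrow> ('a \<Rightarrow>\<^sub>L 'a) \<Rightarrow> complex \<Rightarrow> ('a \<Rightarrow>\<^sub>L 'a) \<Rightarrow> ('a \<Rightarrow>\<^sub>L 'a)"
  where "adi_half_step A B C b Y =
    - (op_inverse (A - scalar_op b) o\<^sub>L Y o\<^sub>L (B + scalar_op b))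
    - (op_inverse (A - scalar_op b) o\<^sub>L C)"

definition adi_full_step ::
  "('a::complex_banach \<Rightarrow>\<^sub>L 'a) \<Rightarrow> ('a \<Rightarrow>\<^sub>L 'a) \<Rightarrow> ('a \<Rightarrow>\<^sub>L 'a) \<Rightarrow> complex \<Rightarrow> ('a \<Rightarrow>\<^sub>L 'a) \<Rightarrow> ('a \<Rightarrow>\<^sub>L 'a)"
  where "adi_full_step A B C a Y =
    - ((A - scalar_op a) o\<^sub>L Y o\<^sub>L op_inverse (B + scalar_op a))
    - (C o\<^sub>L op_inverse (B + scalar_op a))"

primrec adi ::
  "('a::complex_banach \<Rightarrow>\<^sub>L 'a) \<Rightarrow> ('a \<Rightarrow>\<^sub>L 'a) \<Rightarrow> ('a \<Rightarrow>\<^sub>L 'a) \<Rightarrow>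
    (nat \<Rightarrow> complex) \<Rightarrow> (nat \<Rightarrow> complex) \<Rightarrow> nat \<Rightarrow> ('a \<Rightarrow>\<^sub>L 'a)"
  where
    "adi A B C \<alpha> \<beta> 0 = 0"
  | "adi A B C \<alpha> \<beta> (Suc j) =
      adi_full_step A B C (\<alpha> (Suc j)) (adi_half_step A B C (\<beta> (Suc j)) (adi A B C \<alpha> \<beta> j))"

text \<open>
  \<open>adi_rat\<close> is an element of the field of rational functions, so common factors
  (\<open>\<alpha> i = \<beta> j\<close>) cancel: they produce neither zeros nor poles. Accordingly \<open>rat_modulus\<close> evaluates the
  reduced fraction returned by \<open>quot_of_fract\<close>.
\<close>

definition adi_rat :: "(nat \<Rightarrow> complex) \<Rightarrow> (nat \<Rightarrow> complex) \<Rightarrow> nat \<Rightarrow> complex poly fract"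
  where "adi_rat \<alpha> \<beta> k = (\<Prod>j = 1..k. Fract [:- \<alpha> j, 1:] [:- \<beta> j, 1:])"

definition rat_modulus :: "complex poly fract \<Rightarrow> complex \<Rightarrow> ereal"
  where "rat_modulus r z =
    (case quot_of_fract r of (p, q) \<Rightarrow>
      if poly q z = 0 then \<infinity> else ereal (cmod (poly p z / poly q z)))"

end

theory Submission
  imports Defs "HOL-Complex_Analysis.Complex_Analysis"
begin

text \<open>
  One ADI step multiplies the error by \<open>(A - \<alpha>)(A - \<beta>)\<^sup>-\<^sup>1\<close> on the left and by
  \<open>(B + \<beta>)(B + \<alpha>)\<^sup>-\<^sup>1\<close> on the right, so \<open>X - X\<^sub>k = r(A) X r(-B)\<^sup>-\<^sup>1\<close>. If \<open>r\<close> is bounded by \<open>M\<close> on the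
  disc of radius \<open>\<rho>\<^sub>A\<close> about \<open>z\<^sub>A\<close>, Cauchy's estimate bounds its \<open>n\<close>-th Taylor coefficient by
  \<open>M / \<rho>\<^sub>A ^ n\<close>, and summing the Taylor series at \<open>A - z\<^sub>A\<close> gives a geometric series. The other factor
  is the Taylor series of \<open>1 / r(-z)\<close> at \<open>B - z\<^sub>B\<close>. That these series equal the products of operator
  quotients follows by multiplying the power series by the linear factors of the denominator one at a
  time; this needs no more of the functional calculus, and common factors of numerator and denominator
  do no harm.
\<close>

section \<open>Composition of bounded operators\<close>

interpretation blinfun_compose: bounded_bilinear "(o\<^sub>L)"
  by (rule bounded_bilinear_blinfun_compose)

lemma blinfun_compose_assoc: "(R o\<^sub>L S) o\<^sub>L T = R o\<^sub>L (S o\<^sub>L T)"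
  by (rule blinfun_eqI) simp

lemma blinfun_compose_id [simp]: "id_blinfun o\<^sub>L T = T" "T o\<^sub>L id_blinfun = T"
  by (auto intro: blinfun_eqI)

lemmas blinfun_compose_distribs =
  blinfun_compose.add_left blinfun_compose.add_right
  blinfun_compose.diff_left blinfun_compose.diff_right
  blinfun_compose.minus_left blinfun_compose.minus_right

lemma complex_linear_iff_commute:
  "complex_linear T \<longleftrightarrow> (\<forall>z. T o\<^sub>L scalar_op z = scalar_op z o\<^sub>L T)"
proof
  assume "complex_linear T"
  then show "\<forall>z. T o\<^sub>L scalar_op z = scalar_op z o\<^sub>L T"
    by (auto simp: complex_linear_def scalar_op.rep_eq intro: blinfun_eqI)
next
  assume comm: "\<forall>z. T o\<^sub>L scalar_op z = scalar_op z o\<^sub>L T"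
  have "blinfun_apply (T o\<^sub>L scalar_op z) x = blinfun_apply (scalar_op z o\<^sub>L T) x" for z x
    using comm by simp
  then show "complex_linear T"
    by (simp add: complex_linear_def scalar_op.rep_eq)
qed

lemma complex_linear_commute: "complex_linear T \<Longrightarrow> T o\<^sub>L scalar_op z = scalar_op z o\<^sub>L T"
  by (simp add: complex_linear_iff_commute)

lemma scalar_op_add: "scalar_op (a + b) = scalar_op a + scalar_op b"
  by (rule blinfun_eqI) (simp add: scalar_op.rep_eq blinfun.bilinear_simps scaleC_add_left)

lemma scalar_op_0: "scalar_op 0 = 0"
  using scalar_op_add[of 0 0] by simp

lemma scalar_op_minus: "scalar_op (- a) = - scalar_op a"
  using scalar_op_add[of "- a" a] by (metis add.left_inverse eq_neg_iff_add_eq_0 scalar_op_0)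

lemma scalar_op_diff: "scalar_op (a - b) = scalar_op a - scalar_op b"
  using scalar_op_add[of a "- b"] by (simp add: scalar_op_minus)

lemma scalar_op_mult: "scalar_op (a * b) = scalar_op a o\<^sub>L scalar_op b"
  by (rule blinfun_eqI) (simp add: scalar_op.rep_eq scaleC_scaleC)

lemma scalar_op_1: "scalar_op 1 = id_blinfun"
  using scaleC_complex_of_real[of 1] by (intro blinfun_eqI) (simp add: scalar_op.rep_eq)

lemmas scalar_op_simps =
  scalar_op_add scalar_op_0 scalar_op_minus scalar_op_diff scalar_op_mult scalar_op_1

lemma complex_linear_scalar_op [simp]: "complex_linear (scalar_op z)"
  by (simp add: complex_linear_iff_commute mult.commute flip: scalar_op_simps)

lemma complex_linear_diff: "complex_linear S \<Longrightarrow> complex_linear T \<Longrightarrow> complex_linear (S - T)"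
  by (simp add: complex_linear_iff_commute blinfun_compose_distribs)

lemma norm_scalar_op_le: "norm (scalar_op z) \<le> cmod z"
  by (rule norm_blinfun_bound) (simp_all add: scalar_op.rep_eq norm_scaleC)

lemma is_op_inverse_op_inverse:
  assumes "is_op_inverse T S"
  shows "is_op_inverse T (op_inverse T)"
  unfolding op_inverse_def
proof (rule theI)
  fix R assume "is_op_inverse T R"
  then have "R = S o\<^sub>L T o\<^sub>L R"
    using assms by (simp add: is_op_inverse_def)
  also have "\<dots> = S"
    using \<open>is_op_inverse T R\<close> by (simp add: is_op_inverse_def blinfun_compose_assoc)
  finally show "R = S" .
qed fact

lemma is_op_inverse_uminus: "is_op_inverse T S \<Longrightarrow> is_op_inverse (- T) (- S)"
  by (simp add: is_op_inverse_def complex_linear_iff_commute blinfun_compose_distribs)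


section \<open>Products of shifted operators\<close>

primrec shift_prod ::
  "('a::complex_banach \<Rightarrow>\<^sub>L 'a) \<Rightarrow> (nat \<Rightarrow> complex) \<Rightarrow> nat \<Rightarrow> ('a \<Rightarrow>\<^sub>L 'a)"
  where
    "shift_prod T a 0 = id_blinfun"
  | "shift_prod T a (Suc j) = (T - scalar_op (a (Suc j))) o\<^sub>L shift_prod T a j"

lemma shift_prod_commute:
  assumes "complex_linear Y" and "Y o\<^sub>L T = T o\<^sub>L Y"
  shows "Y o\<^sub>L shift_prod T a k = shift_prod T a k o\<^sub>L Y"
proof (induction k)
  case (Suc k)
  have "Y o\<^sub>L shift_prod T a (Suc k)
      = (Y o\<^sub>L (T - scalar_op (a (Suc k)))) o\<^sub>L shift_prod T a k"
    by (simp add: blinfun_compose_assoc)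
  also have "Y o\<^sub>L (T - scalar_op (a (Suc k))) = (T - scalar_op (a (Suc k))) o\<^sub>L Y"
    using assms by (simp add: blinfun_compose_distribs complex_linear_commute)
  finally show ?case
    by (simp add: blinfun_compose_assoc Suc.IH)
qed simp

lemma shift_prod_translate:
  "shift_prod T a k = shift_prod (T - scalar_op z) (\<lambda>j. a j - z) k"
  by (induction k) (simp_all add: scalar_op_simps)

lemma shift_prod_invertible:
  assumes "\<forall>j\<in>{1..k}. \<exists>S. is_op_inverse (T - scalar_op (a j)) S"
  shows "\<exists>S. shift_prod T a k o\<^sub>L S = id_blinfun \<and> S o\<^sub>L shift_prod T a k = id_blinfun"
  using assms
proof (induction k)
  case 0
  show ?case by (intro exI[of _ id_blinfun]) simp
next
  case (Suc k)
  then obtain S where S: "shift_prod T a k o\<^sub>L S = id_blinfun" "S o\<^sub>L shift_prod T a k = id_blinfun"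
    by auto
  obtain R where R: "(T - scalar_op (a (Suc k))) o\<^sub>L R = id_blinfun"
      "R o\<^sub>L (T - scalar_op (a (Suc k))) = id_blinfun"
    using bspec[OF Suc.prems, of "Suc k"] by (auto simp: is_op_inverse_def)
  have "shift_prod T a (Suc k) o\<^sub>L (S o\<^sub>L R)
      = (T - scalar_op (a (Suc k))) o\<^sub>L ((shift_prod T a k o\<^sub>L S) o\<^sub>L R)"
    by (simp only: shift_prod.simps blinfun_compose_assoc)
  moreover have "(S o\<^sub>L R) o\<^sub>L shift_prod T a (Suc k)
      = S o\<^sub>L ((R o\<^sub>L (T - scalar_op (a (Suc k)))) o\<^sub>L shift_prod T a k)"
    by (simp only: shift_prod.simps blinfun_compose_assoc)
  ultimately show ?case
    using R S by (intro exI[of _ "S o\<^sub>L R"]) simp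
qed


section \<open>Power series in an operator\<close>

primrec op_power :: "('a::complex_banach \<Rightarrow>\<^sub>L 'a) \<Rightarrow> nat \<Rightarrow> ('a \<Rightarrow>\<^sub>L 'a)"
  where
    "op_power T 0 = id_blinfun"
  | "op_power T (Suc n) = T o\<^sub>L op_power T n"

lemma op_power_commute: "Y o\<^sub>L T = T o\<^sub>L Y \<Longrightarrow> Y o\<^sub>L op_power T n = op_power T n o\<^sub>L Y"
proof (induction n)
  case (Suc n)
  have "Y o\<^sub>L op_power T (Suc n) = (Y o\<^sub>L T) o\<^sub>L op_power T n"
    by (simp add: blinfun_compose_assoc)
  then show ?case
    using Suc by (simp add: blinfun_compose_assoc)
qed simp

lemma norm_op_power_le: "norm (op_power T n) \<le> norm T ^ n"
proof (induction n)
  case 0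
  show ?case by (simp add: norm_blinfun_id_le)
next
  case (Suc n)
  have "norm (op_power T (Suc n)) \<le> norm T * norm (op_power T n)"
    by (simp add: norm_blinfun_compose)
  also have "\<dots> \<le> norm T * norm T ^ n"
    by (intro mult_left_mono Suc.IH) simp
  finally show ?case by simp
qed

definition op_series_term :: "('a::complex_banach \<Rightarrow>\<^sub>L 'a) \<Rightarrow> complex fps \<Rightarrow> nat \<Rightarrow> ('a \<Rightarrow>\<^sub>L 'a)"
  where "op_series_term T c n = scalar_op (fps_nth c n) o\<^sub>L op_power T n"

lemma norm_op_series_term_le: "norm (op_series_term T c n) \<le> cmod (fps_nth c n) * norm T ^ n"
proof -
  have "norm (op_series_term T c n) \<le> norm (scalar_op (fps_nth c n) :: 'a \<Rightarrow>\<^sub>L 'a) * norm (op_power T n)"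
    unfolding op_series_term_def by (rule norm_blinfun_compose)
  also have "\<dots> \<le> cmod (fps_nth c n) * norm T ^ n"
    by (intro mult_mono norm_scalar_op_le norm_op_power_le) simp_all
  finally show ?thesis .
qed

lemma op_series_mult_linear:
  assumes "complex_linear T" and "op_series_term T c sums F"
  shows "op_series_term T (c * (fps_X - fps_const a)) sums ((T - scalar_op a) o\<^sub>L F)"
proof -
  have "(\<lambda>n. T o\<^sub>L op_series_term T c n) sums (T o\<^sub>L F)"
    using blinfun_compose.bounded_linear_right assms(2) by (rule bounded_linear.sums)
  moreover have "T o\<^sub>L op_series_term T c n = op_series_term T (c * fps_X) (Suc n)" for n
    using complex_linear_commute[OF assms(1)]
    by (simp add: op_series_term_def flip: blinfun_compose_assoc)
  ultimately have "(\<lambda>n. op_series_term T (c * fps_X) (Suc n)) sums (T o\<^sub>L F)"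
    by simp
  then have "op_series_term T (c * fps_X) sums (T o\<^sub>L F)"
    by (subst (asm) sums_Suc_iff) (simp add: op_series_term_def scalar_op_simps)
  moreover have "(\<lambda>n. scalar_op a o\<^sub>L op_series_term T c n) sums (scalar_op a o\<^sub>L F)"
    using blinfun_compose.bounded_linear_right assms(2) by (rule bounded_linear.sums)
  ultimately have "(\<lambda>n. op_series_term T (c * fps_X) n - (scalar_op a o\<^sub>L op_series_term T c n))
      sums ((T o\<^sub>L F) - (scalar_op a o\<^sub>L F))"
    by (rule sums_diff)
  moreover have "(\<lambda>n. op_series_term T (c * fps_X) n - (scalar_op a o\<^sub>L op_series_term T c n))
      = op_series_term T (c * (fps_X - fps_const a))"
    by (rule ext) (simp add: op_series_term_def right_diff_distrib scalar_op_simps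
        blinfun_compose_distribs mult.commute[of _ a] blinfun_compose_assoc)
  ultimately show ?thesis
    by (simp add: blinfun_compose_distribs)
qed

lemma op_series_mult_prod:
  assumes "complex_linear T" and "op_series_term T c sums F"
  shows "op_series_term T (c * (\<Prod>j=1..k. fps_X - fps_const (a j))) sums (shift_prod T a k o\<^sub>L F)"
proof (induction k)
  case (Suc k)
  show ?case
    using op_series_mult_linear[OF assms(1) Suc.IH, of "a (Suc k)"]
    by (simp add: mult.assoc blinfun_compose_assoc)
qed (use assms in simp)

lemma op_series_one: "op_series_term T 1 sums id_blinfun"
proof -
  have "op_series_term T 1 sums (\<Sum>n\<in>{0}. op_series_term T 1 n)"
    by (rule sums_finite) (auto simp: op_series_term_def scalar_op_simps)
  then show ?thesis
    by (simp add: op_series_term_def scalar_op_simps)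
qed

lemma op_series_commute:
  assumes "op_series_term T c sums F" and "complex_linear Y" and "Y o\<^sub>L T = T o\<^sub>L Y"
  shows "Y o\<^sub>L F = F o\<^sub>L Y"
proof -
  have "(\<lambda>n. Y o\<^sub>L op_series_term T c n) sums (Y o\<^sub>L F)"
    using blinfun_compose.bounded_linear_right assms(1) by (rule bounded_linear.sums)
  moreover have "(\<lambda>n. op_series_term T c n o\<^sub>L Y) sums (F o\<^sub>L Y)"
    using blinfun_compose.bounded_linear_left assms(1) by (rule bounded_linear.sums)
  moreover have "Y o\<^sub>L op_series_term T c n = op_series_term T c n o\<^sub>L Y" for n
  proof -
    have "Y o\<^sub>L op_series_term T c n = (Y o\<^sub>L scalar_op (fps_nth c n)) o\<^sub>L op_power T n"
      by (simp add: op_series_term_def blinfun_compose_assoc)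
    also have "\<dots> = scalar_op (fps_nth c n) o\<^sub>L (Y o\<^sub>L op_power T n)"
      using assms(2) by (simp add: complex_linear_commute blinfun_compose_assoc)
    also have "\<dots> = op_series_term T c n o\<^sub>L Y"
      using op_power_commute[OF assms(3)] by (simp add: op_series_term_def blinfun_compose_assoc)
    finally show ?thesis .
  qed
  ultimately show ?thesis
    by (simp add: sums_unique2)
qed

lemma Cauchy_inequality_open_ball:
  assumes "f holomorphic_on ball z \<rho>" and "\<rho> > 0" and "\<And>w. w \<in> ball z \<rho> \<Longrightarrow> cmod (f w) \<le> M"
  shows "cmod (fps_nth (fps_expansion f z) n) \<le> M / \<rho> ^ n"
proof -
  have bound: "cmod (fps_nth (fps_expansion f z) n) * r ^ n \<le> M" if "0 < r" "r < \<rho>" for r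
  proof -
    have sub: "cball z r \<subseteq> ball z \<rho>"
      using that by auto
    have "cmod ((deriv ^^ n) f z) \<le> fact n * M / r ^ n"
    proof (rule Cauchy_inequality)
      show "f holomorphic_on ball z r"
        using assms(1) by (rule holomorphic_on_subset) (use that in auto)
      show "continuous_on (cball z r) f"
        using assms(1) sub by (meson continuous_on_subset holomorphic_on_imp_continuous_on)
      show "cmod (f w) \<le> M" if "cmod (z - w) = r" for w
        using that \<open>r < \<rho>\<close> by (intro assms(3)) (simp add: dist_norm)
    qed fact
    then show ?thesis
      using \<open>0 < r\<close> by (simp add: fps_expansion_def norm_divide field_simps)
  qed
  have "((\<lambda>r. cmod (fps_nth (fps_expansion f z) n) * r ^ n)
      \<longlongrightarrow> cmod (fps_nth (fps_expansion f z) n) * \<rho> ^ n) (at_left \<rho>)"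
    by (intro tendsto_intros)
  moreover have "eventually (\<lambda>r. cmod (fps_nth (fps_expansion f z) n) * r ^ n \<le> M) (at_left \<rho>)"
    using eventually_at_left_real[OF \<open>\<rho> > 0\<close>] by eventually_elim (simp add: bound)
  ultimately have "cmod (fps_nth (fps_expansion f z) n) * \<rho> ^ n \<le> M"
    by (rule tendsto_upperbound) simp
  then show ?thesis
    using \<open>\<rho> > 0\<close> by (simp add: field_simps)
qed

lemma ratio_of_shift_prods_bound:
  fixes T :: "'a::complex_banach \<Rightarrow>\<^sub>L 'a"
  assumes "complex_linear T" and T: "norm (T - scalar_op z) \<le> \<rho>'" and "\<rho>' < \<rho>"
    and f: "f holomorphic_on ball z \<rho>" and M: "\<And>w. w \<in> ball z \<rho> \<Longrightarrow> cmod (f w) \<le> M"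
    and eq: "\<And>w. w \<in> ball z \<rho> \<Longrightarrow> f w * (\<Prod>j=1..k. w - b j) = (\<Prod>j=1..k. w - a j)"
  obtains F where "norm F \<le> M * \<rho> / (\<rho> - \<rho>')"
    and "shift_prod T b k o\<^sub>L F = shift_prod T a k"
    and "F o\<^sub>L shift_prod T b k = shift_prod T a k"
proof -
  define S where "S = T - scalar_op z"
  have S: "complex_linear S" "norm S \<le> \<rho>'"
    using assms by (simp_all add: S_def complex_linear_diff)
  have pos: "0 \<le> \<rho>'" "0 < \<rho>"
    using S(2) norm_ge_zero[of S] \<open>\<rho>' < \<rho>\<close> by linarith+
  have "M \<ge> 0"
    using order_trans[OF norm_ge_zero M[of z]] pos by simp
  define c where "c = fps_expansion f z"
  have term_le: "norm (op_series_term S c n) \<le> M * (\<rho>' / \<rho>) ^ n" for n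
  proof -
    have "norm (op_series_term S c n) \<le> cmod (fps_nth c n) * norm S ^ n"
      by (rule norm_op_series_term_le)
    also have "\<dots> \<le> (M / \<rho> ^ n) * \<rho>' ^ n"
      unfolding c_def using pos \<open>M \<ge> 0\<close>
      by (intro mult_mono Cauchy_inequality_open_ball f M power_mono S) auto
    finally show ?thesis
      by (simp add: power_divide)
  qed
  have geom: "(\<lambda>n. M * (\<rho>' / \<rho>) ^ n) sums (M * (1 / (1 - \<rho>' / \<rho>)))"
    using pos \<open>\<rho>' < \<rho>\<close> by (intro sums_mult geometric_sums) simp
  have summable: "summable (\<lambda>n. norm (op_series_term S c n))"
    using term_le by (intro summable_comparison_test'[OF sums_summable[OF geom]]) simp
  define F where "F = suminf (op_series_term S c)"
  have F: "op_series_term S c sums F"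
    unfolding F_def by (rule summable_sums[OF summable_norm_cancel[OF summable]])
  have "norm F \<le> (\<Sum>n. norm (op_series_term S c n))"
    unfolding F_def by (rule summable_norm[OF summable])
  also have "\<dots> \<le> M * (1 / (1 - \<rho>' / \<rho>))"
    using suminf_le[OF term_le summable sums_summable[OF geom]] sums_unique[OF geom] by simp
  also have "\<dots> = M * \<rho> / (\<rho> - \<rho>')"
    using pos \<open>\<rho>' < \<rho>\<close> by (simp add: field_simps)
  finally have normF: "norm F \<le> M * \<rho> / (\<rho> - \<rho>')" .

  have shift: "(\<lambda>w. \<Prod>j=1..k. z + w - d j) has_fps_expansion
      (\<Prod>j=1..k. fps_X - fps_const (d j - z))" for d :: "nat \<Rightarrow> complex"
  proof -
    have "(\<lambda>w. w - (d j - z)) has_fps_expansion (fps_X - fps_const (d j - z))" for j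
      by (intro fps_expansion_intros)
    then have "(\<lambda>w. \<Prod>j=1..k. w - (d j - z)) has_fps_expansion
      (\<Prod>j=1..k. fps_X - fps_const (d j - z))"
      by (intro has_fps_expansion_prod)
    then show ?thesis
      by (simp add: algebra_simps)
  qed
  have "(\<lambda>w. f (z + w)) has_fps_expansion c"
    unfolding c_def using f pos
    by (intro analytic_at_imp_has_fps_expansion) (auto simp: analytic_at intro!: exI[of _ "ball z \<rho>"])
  then have "(\<lambda>w. f (z + w) * (\<Prod>j=1..k. z + w - b j)) has_fps_expansion
      c * (\<Prod>j=1..k. fps_X - fps_const (b j - z))"
    by (intro has_fps_expansion_mult shift)
  moreover have "eventually (\<lambda>w. w \<in> ball 0 \<rho>) (nhds (0::complex))"
    using pos by (intro eventually_nhds_in_open) auto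
  then have "eventually (\<lambda>w. f (z + w) * (\<Prod>j=1..k. z + w - b j) = (\<Prod>j=1..k. z + w - a j)) (nhds 0)"
    by eventually_elim (intro eq, simp add: dist_norm)
  ultimately have "(\<lambda>w. \<Prod>j=1..k. z + w - a j) has_fps_expansion
      c * (\<Prod>j=1..k. fps_X - fps_const (b j - z))"
    by (subst has_fps_expansion_cong[OF _ refl, symmetric])
  then have c_eq: "c * (\<Prod>j=1..k. fps_X - fps_const (b j - z)) = (\<Prod>j=1..k. fps_X - fps_const (a j - z))"
    using shift[of a] fps_expansion_unique_complex by metis
  have "op_series_term S (\<Prod>j=1..k. fps_X - fps_const (a j - z))
      sums (shift_prod S (\<lambda>j. b j - z) k o\<^sub>L F)"
    using op_series_mult_prod[OF S(1) F, of "\<lambda>j. b j - z" k] c_eq by simp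
  moreover have "op_series_term S (\<Prod>j=1..k. fps_X - fps_const (a j - z))
      sums shift_prod S (\<lambda>j. a j - z) k"
    using op_series_mult_prod[OF S(1) op_series_one, of "\<lambda>j. a j - z" k] by simp
  ultimately have left: "shift_prod T b k o\<^sub>L F = shift_prod T a k"
    unfolding shift_prod_translate[of T _ k z] S_def[symmetric] by (rule sums_unique2)
  have "complex_linear F"
    unfolding complex_linear_iff_commute
    using op_series_commute[OF F complex_linear_scalar_op] complex_linear_commute[OF S(1)] by simp
  moreover have "F o\<^sub>L S = S o\<^sub>L F"
    using op_series_commute[OF F S(1)] by simp
  ultimately have "F o\<^sub>L shift_prod T b k = shift_prod T b k o\<^sub>L F"
    unfolding shift_prod_translate[of T _ k z] S_def[symmetric] by (rule shift_prod_commute)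
  with left normF show ?thesis
    by (intro that) auto
qed


section \<open>The error of the ADI iteration\<close>

lemma adi_error_step:
  assumes "complex_linear A" and sol: "(A o\<^sub>L X) + (X o\<^sub>L B) + C = 0"
    and "\<exists>S. is_op_inverse (A - scalar_op b) S" and "\<exists>S. is_op_inverse (B + scalar_op a) S"
    and "complex_linear X"
  shows "(A - scalar_op b) o\<^sub>L (X - adi_full_step A B C a (adi_half_step A B C b Y)) o\<^sub>L (B + scalar_op a)
    = (A - scalar_op a) o\<^sub>L (X - Y) o\<^sub>L (B + scalar_op b)"
proof -
  define R where "R = op_inverse (A - scalar_op b)"
  define S where "S = op_inverse (B + scalar_op a)"
  define H where "H = adi_half_step A B C b Y"
  have R: "(A - scalar_op b) o\<^sub>L R = id_blinfun"
    using assms(3) is_op_inverse_op_inverse by (auto simp: R_def is_op_inverse_def)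
  have S: "S o\<^sub>L (B + scalar_op a) = id_blinfun"
    using assms(4) is_op_inverse_op_inverse by (auto simp: S_def is_op_inverse_def)
  have C: "C = - (A o\<^sub>L X) - (X o\<^sub>L B)"
    using sol by (simp add: eq_neg_iff_add_eq_0 algebra_simps)
  have sol': "(A - scalar_op z) o\<^sub>L X = - C - (X o\<^sub>L (B + scalar_op z))" for z
    using complex_linear_commute[OF assms(5), of z] by (simp add: C blinfun_compose_distribs)
  have "(A - scalar_op b) o\<^sub>L H = - (((A - scalar_op b) o\<^sub>L R) o\<^sub>L (Y o\<^sub>L (B + scalar_op b)))
      - (((A - scalar_op b) o\<^sub>L R) o\<^sub>L C)"
    unfolding H_def adi_half_step_def R_def
    by (simp only: blinfun_compose.diff_right blinfun_compose.minus_right blinfun_compose_assoc)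
  then have half: "(A - scalar_op b) o\<^sub>L (X - H) = - ((X - Y) o\<^sub>L (B + scalar_op b))"
    using sol'[of b] R
    by (simp add: blinfun_compose.diff_right[of _ X H] blinfun_compose.diff_left[of X Y])
  have "adi_full_step A B C a H o\<^sub>L (B + scalar_op a)
      = - ((A - scalar_op a) o\<^sub>L H o\<^sub>L (S o\<^sub>L (B + scalar_op a))) - (C o\<^sub>L (S o\<^sub>L (B + scalar_op a)))"
    unfolding adi_full_step_def S_def
    by (simp only: blinfun_compose.diff_left blinfun_compose.minus_left blinfun_compose_assoc)
  then have full: "(X - adi_full_step A B C a H) o\<^sub>L (B + scalar_op a) = - ((A - scalar_op a) o\<^sub>L (X - H))"
    using sol'[of a] S
    by (simp add: blinfun_compose.diff_right[of _ X H] blinfun_compose.diff_left[of X])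
  have "(A - scalar_op b) o\<^sub>L (A - scalar_op a) = (A - scalar_op a) o\<^sub>L (A - scalar_op b)"
    using complex_linear_commute[OF assms(1)] complex_linear_commute[OF complex_linear_scalar_op]
    by (simp add: blinfun_compose_distribs)
  then have "(A - scalar_op b) o\<^sub>L ((A - scalar_op a) o\<^sub>L (X - H))
      = (A - scalar_op a) o\<^sub>L ((A - scalar_op b) o\<^sub>L (X - H))"
    by (metis blinfun_compose_assoc)
  then show ?thesis
    using full half unfolding H_def[symmetric]
    by (simp add: blinfun_compose_assoc blinfun_compose.minus_right)
qed

lemma adi_error:
  fixes A B C X :: "'a::complex_banach \<Rightarrow>\<^sub>L 'a"
  assumes "complex_linear A" and "complex_linear B" and "complex_linear X"
    and "(A o\<^sub>L X) + (X o\<^sub>L B) + C = 0"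
    and "\<forall>j\<in>{1..k}. \<exists>S. is_op_inverse (A - scalar_op (\<beta> j)) S"
    and "\<forall>j\<in>{1..k}. \<exists>S. is_op_inverse (B + scalar_op (\<alpha> j)) S"
  shows "shift_prod A \<beta> k o\<^sub>L (X - adi A B C \<alpha> \<beta> k) o\<^sub>L shift_prod B (\<lambda>j. - \<alpha> j) k
    = shift_prod A \<alpha> k o\<^sub>L X o\<^sub>L shift_prod B (\<lambda>j. - \<beta> j) k"
  using assms(5,6)
proof (induction k)
  case (Suc k)
  have commute: "(T - scalar_op z) o\<^sub>L shift_prod T d k = shift_prod T d k o\<^sub>L (T - scalar_op z)"
    if "complex_linear T" for T :: "'a \<Rightarrow>\<^sub>L 'a" and z d
    using that complex_linear_commute[OF that]
    by (intro shift_prod_commute complex_linear_diff complex_linear_scalar_op)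
       (simp_all add: blinfun_compose_distribs)
  note A = commute[OF assms(1)]
  have B: "(B + scalar_op z) o\<^sub>L shift_prod B d k = shift_prod B d k o\<^sub>L (B + scalar_op z)" for z d
    using commute[OF assms(2), of "- z"] by (simp add: scalar_op_minus)
  define Qa where "Qa = shift_prod A \<beta> k"
  define Pa where "Pa = shift_prod A \<alpha> k"
  define Pb where "Pb = shift_prod B (\<lambda>j. - \<alpha> j) k"
  define Qb where "Qb = shift_prod B (\<lambda>j. - \<beta> j) k"
  define E where "E = X - adi A B C \<alpha> \<beta> k"
  define E' where "E' = X - adi A B C \<alpha> \<beta> (Suc k)"
  define a where "a = (scalar_op (\<alpha> (Suc k)) :: 'a \<Rightarrow>\<^sub>L 'a)"
  define b where "b = (scalar_op (\<beta> (Suc k)) :: 'a \<Rightarrow>\<^sub>L 'a)"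
  have "(A - b) o\<^sub>L E' o\<^sub>L (B + a) = (A - a) o\<^sub>L E o\<^sub>L (B + b)"
    unfolding E'_def E_def a_def b_def adi.simps
    by (rule adi_error_step[OF assms(1,4) bspec[OF Suc.prems(1)] bspec[OF Suc.prems(2)] assms(3)])
       simp_all
  then have step: "(A - b) o\<^sub>L (E' o\<^sub>L (B + a)) = (A - a) o\<^sub>L (E o\<^sub>L (B + b))"
    by (simp only: blinfun_compose_assoc)
  have IH: "Qa o\<^sub>L (E o\<^sub>L Pb) = Pa o\<^sub>L (X o\<^sub>L Qb)"
    using Suc by (simp add: Qa_def E_def Pb_def Pa_def Qb_def blinfun_compose_assoc)
  have "((A - b) o\<^sub>L Qa) o\<^sub>L E' o\<^sub>L ((B + a) o\<^sub>L Pb) = Qa o\<^sub>L ((A - b) o\<^sub>L (E' o\<^sub>L (B + a))) o\<^sub>L Pb"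
    by (simp only: Qa_def b_def A blinfun_compose_assoc)
  also have "\<dots> = (Qa o\<^sub>L (A - a)) o\<^sub>L E o\<^sub>L ((B + b) o\<^sub>L Pb)"
    by (simp only: step blinfun_compose_assoc)
  also have "\<dots> = ((A - a) o\<^sub>L Qa) o\<^sub>L E o\<^sub>L (Pb o\<^sub>L (B + b))"
    unfolding Qa_def Pb_def a_def b_def by (simp only: A B)
  also have "\<dots> = (A - a) o\<^sub>L (Qa o\<^sub>L (E o\<^sub>L Pb)) o\<^sub>L (B + b)"
    by (simp only: blinfun_compose_assoc)
  also have "\<dots> = (A - a) o\<^sub>L Pa o\<^sub>L X o\<^sub>L (Qb o\<^sub>L (B + b))"
    by (simp only: IH blinfun_compose_assoc)
  also have "Qb o\<^sub>L (B + b) = (B + b) o\<^sub>L Qb"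
    unfolding Qb_def b_def by (simp only: B)
  finally show ?case
    unfolding shift_prod.simps scalar_op_minus diff_minus_eq_add
      E'_def Qa_def Pa_def Pb_def Qb_def a_def b_def .
qed simp


section \<open>Reduced fractions\<close>

lemma adi_rat_eq_Fract:
  "adi_rat \<alpha> \<beta> k = Fract (\<Prod>j=1..k. [:- \<alpha> j, 1:]) (\<Prod>j=1..k. [:- \<beta> j, 1:])"
proof -
  have "(\<Prod>j\<in>J. Fract [:- \<alpha> j, 1:] [:- \<beta> j, 1:])
      = Fract (\<Prod>j\<in>J. [:- \<alpha> j, 1:]) (\<Prod>j\<in>J. [:- \<beta> j, 1:])" if "finite J" for J
    using that by induction (simp_all add: One_fract_def)
  then show ?thesis
    by (simp add: adi_rat_def)
qed

lemma adi_rat_reduced: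
  obtains p q where "quot_of_fract (adi_rat \<alpha> \<beta> k) = (p, q)" and "q \<noteq> 0"
    and "\<And>z. \<not> (poly p z = 0 \<and> poly q z = 0)"
    and "\<And>z. poly p z * (\<Prod>j=1..k. z - \<beta> j) = (\<Prod>j=1..k. z - \<alpha> j) * poly q z"
proof -
  obtain p q where pq: "quot_of_fract (adi_rat \<alpha> \<beta> k) = (p, q)"
    by force
  have q: "q \<noteq> 0"
    using snd_quot_of_fract_nonzero[of "adi_rat \<alpha> \<beta> k"] pq by simp
  have "coprime p q"
    using coprime_quot_of_fract[of "adi_rat \<alpha> \<beta> k"] pq by simp
  have "\<not> (poly p z = 0 \<and> poly q z = 0)" for z
  proof
    assume "poly p z = 0 \<and> poly q z = 0"
    then have "[:- z, 1:] dvd p" "[:- z, 1:] dvd q"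
      by (simp_all add: poly_eq_0_iff_dvd)
    with \<open>coprime p q\<close> have "is_unit [:- z, 1:]"
      by (rule coprime_common_divisor)
    then show False
      by (simp add: is_unit_iff_degree)
  qed
  moreover have "Fract p q = adi_rat \<alpha> \<beta> k"
    using Fract_quot_of_fract[of "adi_rat \<alpha> \<beta> k"] pq by simp
  then have "p * (\<Prod>j=1..k. [:- \<beta> j, 1:]) = (\<Prod>j=1..k. [:- \<alpha> j, 1:]) * q"
    using q by (simp add: adi_rat_eq_Fract eq_fract)
  then have "poly (p * (\<Prod>j=1..k. [:- \<beta> j, 1:])) z = poly ((\<Prod>j=1..k. [:- \<alpha> j, 1:]) * q) z" for z
    by simp
  then have "poly p z * (\<Prod>j=1..k. z - \<beta> j) = (\<Prod>j=1..k. z - \<alpha> j) * poly q z" for z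
    by (simp add: poly_prod)
  ultimately show ?thesis
    using pq q that by blast
qed

theorem theorem3p5:
  fixes A B C X :: "'a::complex_banach \<Rightarrow>\<^sub>L 'a"
    and \<alpha> \<beta> :: "nat \<Rightarrow> complex" and k :: nat
    and z\<^sub>A z\<^sub>B :: complex
    and \<rho>\<^sub>A \<rho>\<^sub>A' \<rho>\<^sub>B \<rho>\<^sub>B' :: real
  assumes "complex_linear A" and "complex_linear B" and "complex_linear C"
    and "complex_linear X"
    and "(A o\<^sub>L X) + (X o\<^sub>L B) + C = 0"
    and "k \<ge> 1"
    and "\<forall>j\<in>{1..k}. \<beta> j \<notin> spectrum A"
    and "\<forall>j\<in>{1..k}. \<alpha> j \<notin> spectrum (- B)"
    and "norm (A - scalar_op z\<^sub>A) \<le> \<rho>\<^sub>A'" and "\<rho>\<^sub>A' < \<rho>\<^sub>A"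
    and "norm (B - scalar_op z\<^sub>B) \<le> \<rho>\<^sub>B'" and "\<rho>\<^sub>B' < \<rho>\<^sub>B"
  shows "ereal (norm (X - adi A B C \<alpha> \<beta> k)) \<le>
    (let S = (SUP z\<in>ball z\<^sub>A \<rho>\<^sub>A. rat_modulus (adi_rat \<alpha> \<beta> k) z);
         I = (INF z\<in>ball z\<^sub>B \<rho>\<^sub>B. rat_modulus (adi_rat \<alpha> \<beta> k) (- z))
     in if S = \<infinity> \<or> I = 0 then \<infinity>
        else ereal (norm X * (\<rho>\<^sub>A * \<rho>\<^sub>B / ((\<rho>\<^sub>A - \<rho>\<^sub>A') * (\<rho>\<^sub>B - \<rho>\<^sub>B')))) * (S / I))"
proof -
  define S where "S = (SUP z\<in>ball z\<^sub>A \<rho>\<^sub>A. rat_modulus (adi_rat \<alpha> \<beta> k) z)"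
  define I where "I = (INF z\<in>ball z\<^sub>B \<rho>\<^sub>B. rat_modulus (adi_rat \<alpha> \<beta> k) (- z))"
  obtain p q where pq: "quot_of_fract (adi_rat \<alpha> \<beta> k) = (p, q)" and "q \<noteq> 0"
    and no_common_root: "\<And>z. \<not> (poly p z = 0 \<and> poly q z = 0)"
    and cross: "\<And>z. poly p z * (\<Prod>j=1..k. z - \<beta> j) = (\<Prod>j=1..k. z - \<alpha> j) * poly q z"
    using adi_rat_reduced[of \<alpha> \<beta> k] by blast
  have modulus: "rat_modulus (adi_rat \<alpha> \<beta> k) z =
      (if poly q z = 0 then \<infinity> else ereal (cmod (poly p z / poly q z)))" for z
    by (simp add: rat_modulus_def pq)
  have modulus_nonneg: "rat_modulus (adi_rat \<alpha> \<beta> k) z \<ge> 0" for z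
    by (simp add: modulus)
  have S_upper: "rat_modulus (adi_rat \<alpha> \<beta> k) z \<le> S" if "z \<in> ball z\<^sub>A \<rho>\<^sub>A" for z
    unfolding S_def using that by (rule SUP_upper)
  have I_lower: "I \<le> rat_modulus (adi_rat \<alpha> \<beta> k) (- z)" if "z \<in> ball z\<^sub>B \<rho>\<^sub>B" for z
    unfolding I_def using that by (rule INF_lower)
  have "\<rho>\<^sub>A > 0" "\<rho>\<^sub>B > 0"
    using assms(9-12) norm_ge_zero[of "A - scalar_op z\<^sub>A"] norm_ge_zero[of "B - scalar_op z\<^sub>B"]
    by linarith+
  have "S \<ge> 0"
    using S_upper[of z\<^sub>A] modulus_nonneg[of z\<^sub>A] \<open>\<rho>\<^sub>A > 0\<close> by (auto intro: order_trans)
  have "I \<ge> 0"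
    unfolding I_def by (intro INF_greatest modulus_nonneg)
  have "I \<noteq> \<infinity>"
  proof -
    have "finite (uminus ` {z. poly q z = 0})"
      using poly_roots_finite[OF \<open>q \<noteq> 0\<close>] by simp
    moreover have "infinite (ball z\<^sub>B \<rho>\<^sub>B)"
      using uncountable_ball[OF \<open>\<rho>\<^sub>B > 0\<close>] countable_finite by blast
    ultimately obtain z where z: "z \<in> ball z\<^sub>B \<rho>\<^sub>B" "z \<notin> uminus ` {z. poly q z = 0}"
      by (meson finite_subset subsetI)
    then have "poly q (- z) \<noteq> 0"
      by (metis (mono_tags, lifting) image_eqI mem_Collect_eq minus_minus)
    then show ?thesis
      using I_lower[OF z(1)] by (auto simp: modulus)
  qed
  have "ereal (norm (X - adi A B C \<alpha> \<beta> k)) \<le>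
      ereal (norm X * (\<rho>\<^sub>A * \<rho>\<^sub>B / ((\<rho>\<^sub>A - \<rho>\<^sub>A') * (\<rho>\<^sub>B - \<rho>\<^sub>B')))) * (S / I)"
    if "S \<noteq> \<infinity>" "I \<noteq> 0"
  proof -
    obtain s where s: "S = ereal s" "s \<ge> 0"
      using \<open>S \<ge> 0\<close> \<open>S \<noteq> \<infinity>\<close> by (cases S) auto
    obtain i where i: "I = ereal i" "i > 0"
      using \<open>I \<ge> 0\<close> \<open>I \<noteq> 0\<close> \<open>I \<noteq> \<infinity>\<close> by (cases I) auto
    have q_nz: "poly q z \<noteq> 0" and r_le: "cmod (poly p z / poly q z) \<le> s"
      if "z \<in> ball z\<^sub>A \<rho>\<^sub>A" for z
      using S_upper[OF that] by (auto simp: modulus s split: if_splits)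
    have p_nz: "poly p (- z) \<noteq> 0" and r_ge: "cmod (poly q (- z) / poly p (- z)) \<le> 1 / i"
      if "z \<in> ball z\<^sub>B \<rho>\<^sub>B" for z
    proof -
      show nz: "poly p (- z) \<noteq> 0"
        using I_lower[OF that] no_common_root[of "- z"] i by (auto simp: modulus split: if_splits)
      show "cmod (poly q (- z) / poly p (- z)) \<le> 1 / i"
        using I_lower[OF that] nz i
        by (cases "poly q (- z) = 0") (auto simp: modulus norm_divide field_simps)
    qed
    obtain F where normF: "norm F \<le> s * \<rho>\<^sub>A / (\<rho>\<^sub>A - \<rho>\<^sub>A')"
      and F: "shift_prod A \<beta> k o\<^sub>L F = shift_prod A \<alpha> k"
    proof (rule ratio_of_shift_prods_bound)
      show "(\<lambda>z. poly p z / poly q z) holomorphic_on ball z\<^sub>A \<rho>\<^sub>A"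
        using q_nz by (intro holomorphic_intros) auto
      show "poly p z / poly q z * (\<Prod>j=1..k. z - \<beta> j) = (\<Prod>j=1..k. z - \<alpha> j)"
        if "z \<in> ball z\<^sub>A \<rho>\<^sub>A" for z
        using q_nz[OF that] cross[of z] by (simp add: field_simps)
    qed (use assms r_le in auto)
    obtain G where normG: "norm G \<le> 1 / i * \<rho>\<^sub>B / (\<rho>\<^sub>B - \<rho>\<^sub>B')"
      and G: "G o\<^sub>L shift_prod B (\<lambda>j. - \<alpha> j) k = shift_prod B (\<lambda>j. - \<beta> j) k"
    proof (rule ratio_of_shift_prods_bound)
      show "(\<lambda>z. poly q (- z) / poly p (- z)) holomorphic_on ball z\<^sub>B \<rho>\<^sub>B"
        using p_nz by (intro holomorphic_intros) auto
      show "poly q (- z) / poly p (- z) * (\<Prod>j=1..k. z - - \<alpha> j) = (\<Prod>j=1..k. z - - \<beta> j)"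
        if "z \<in> ball z\<^sub>B \<rho>\<^sub>B" for z
      proof -
        have neg: "(\<Prod>j=1..k. - z - d j) = (- 1) ^ k * (\<Prod>j=1..k. z - - d j)"
          for d :: "nat \<Rightarrow> complex"
        proof -
          have "(\<Prod>j=1..k. - z - d j) = (\<Prod>j=1..k. (- 1) * (z - - d j))"
            by simp
          also have "\<dots> = (- 1) ^ k * (\<Prod>j=1..k. z - - d j)"
            unfolding prod.distrib by simp
          finally show ?thesis .
        qed
        show ?thesis
          using p_nz[OF that] cross[of "- z"] unfolding neg by (simp add: field_simps)
      qed
    qed (use assms r_ge in auto)
    have invA: "\<forall>j\<in>{1..k}. \<exists>S. is_op_inverse (A - scalar_op (\<beta> j)) S"
      using assms(7) by (simp add: spectrum_def)
    have invB: "\<forall>j\<in>{1..k}. \<exists>S. is_op_inverse (B + scalar_op (\<alpha> j)) S"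
    proof
      fix j assume "j \<in> {1..k}"
      then obtain R where "is_op_inverse (- B - scalar_op (\<alpha> j)) R"
        using assms(8) unfolding spectrum_def by blast
      from is_op_inverse_uminus[OF this] have "is_op_inverse (B + scalar_op (\<alpha> j)) (- R)"
        by (simp add: add.commute)
      then show "\<exists>S. is_op_inverse (B + scalar_op (\<alpha> j)) S" ..
    qed
    define E where "E = X - adi A B C \<alpha> \<beta> k"
    define Qa where "Qa = shift_prod A \<beta> k"
    define Pb where "Pb = shift_prod B (\<lambda>j. - \<alpha> j) k"
    obtain Qa' where Qa': "Qa' o\<^sub>L Qa = id_blinfun"
      using shift_prod_invertible[OF invA] unfolding Qa_def by blast
    obtain Pb' where Pb': "Pb o\<^sub>L Pb' = id_blinfun"
      using shift_prod_invertible[of k B "\<lambda>j. - \<alpha> j"] invB unfolding Pb_def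
      by (auto simp: scalar_op_minus)
    have error: "Qa o\<^sub>L E o\<^sub>L Pb = (Qa o\<^sub>L F) o\<^sub>L X o\<^sub>L (G o\<^sub>L Pb)"
      unfolding Qa_def Pb_def F G E_def using assms(1,2,4,5) invA invB by (rule adi_error)
    have "E = (Qa' o\<^sub>L Qa) o\<^sub>L E o\<^sub>L (Pb o\<^sub>L Pb')"
      by (simp add: Qa' Pb')
    also have "\<dots> = Qa' o\<^sub>L (Qa o\<^sub>L E o\<^sub>L Pb) o\<^sub>L Pb'"
      by (simp only: blinfun_compose_assoc)
    also have "\<dots> = (Qa' o\<^sub>L Qa) o\<^sub>L (F o\<^sub>L X o\<^sub>L G) o\<^sub>L (Pb o\<^sub>L Pb')"
      unfolding error by (simp only: blinfun_compose_assoc)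
    finally have "E = F o\<^sub>L X o\<^sub>L G"
      by (simp add: Qa' Pb')
    then have "norm E \<le> norm (F o\<^sub>L X) * norm G"
      by (simp add: norm_blinfun_compose)
    also have "\<dots> \<le> (norm F * norm X) * norm G"
      by (intro mult_right_mono norm_blinfun_compose) simp
    also have "\<dots> \<le> (s * \<rho>\<^sub>A / (\<rho>\<^sub>A - \<rho>\<^sub>A') * norm X) * (1 / i * \<rho>\<^sub>B / (\<rho>\<^sub>B - \<rho>\<^sub>B'))"
      using s i \<open>\<rho>\<^sub>A > 0\<close> assms(10) by (intro mult_mono normF normG) simp_all
    also have "\<dots> = norm X * (\<rho>\<^sub>A * \<rho>\<^sub>B / ((\<rho>\<^sub>A - \<rho>\<^sub>A') * (\<rho>\<^sub>B - \<rho>\<^sub>B'))) * (s / i)"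
      by (simp add: mult_ac)
    finally show ?thesis
      using i by (simp add: E_def s)
  qed
  then show ?thesis
    unfolding Let_def S_def I_def by simp
qed

end
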